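(* Let $J:[0,\infty)\to[0,\infty)$ be subexponentially bounded, i.e. for every $\alpha>0$ there exists $C_\alpha\ge0$ with $J(r)\le C_\alpha\exp(\alpha r)$ for all $r>0$. Let $b>0$ be arbitrary. Then for every $\delta>0$ there exist arbitrarily large $r>0$ with $J(r+b)\le e^{\delta}J(r)$. *)

theory Defs
  imports Complex_Main "HOL-Library.FuncSet"
begin

definition subexponentially_bounded :: "(real \<Rightarrow> real) \<Rightarrow> bool" where
  "subexponentially_bounded J \<longleftrightarrow>
     (\<forall>\<alpha>>0. \<exists>C\<ge>0. \<forall>r>0. J r \<le> C * exp (\<alpha> * r))"

end

theory Submission
  imports Defs
begin

text \<open>
  If the inequality failed for all large \<open>r\<close>, then \<open>J\<close> would grow at least like
  \<open>exp (n * \<delta>)\<close> along an arithmetic progression \<open>s + n * b\<close>, contradicting the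
  subexponential bound at rate \<open>\<delta> / (2 * b)\<close>.
\<close>

theorem lemma4p2:
  fixes J :: "real \<Rightarrow> real" and b :: real
  assumes "J \<in> {0..} \<rightarrow> {0..}"
    and "subexponentially_bounded J"
    and "b > 0"
  shows "\<forall>\<delta>>0. \<forall>R. \<exists>r>R. r > 0 \<and> J (r + b) \<le> exp \<delta> * J r"
proof (rule ccontr)
  assume "\<not> ?thesis"
  then obtain \<delta> R where \<delta>: "\<delta> > 0"
    and growth: "\<And>r. r > R \<Longrightarrow> r > 0 \<Longrightarrow> exp \<delta> * J r < J (r + b)"
    by (auto simp: not_le)
  define s where "s = max R 0 + 1 + b"
  have s: "s > R" "s > 0"
    using \<open>b > 0\<close> by (auto simp: s_def)
  \<comment> \<open>Starting one step late makes the initial value strictly positive.\<close>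
  have "0 \<le> exp \<delta> * J (max R 0 + 1)"
    using assms(1) by (auto simp: Pi_iff)
  also have "\<dots> < J s"
    unfolding s_def by (rule growth) auto
  finally have Js: "J s > 0" .
  have lower: "exp (n * \<delta>) * J s \<le> J (s + n * b)" for n :: nat
  proof (induction n)
    case 0
    show ?case by simp
  next
    case (Suc n)
    have "exp (Suc n * \<delta>) * J s = exp \<delta> * (exp (n * \<delta>) * J s)"
      by (simp add: algebra_simps exp_add)
    also have "\<dots> \<le> exp \<delta> * J (s + n * b)"
      using Suc by (intro mult_left_mono) auto
    also have "\<dots> \<le> J (s + n * b + b)"
      using s \<open>b > 0\<close>
      by (intro less_imp_le growth) (auto intro: order_less_le_trans add_pos_nonneg)
    finally show ?case by (simp add: algebra_simps)
  qed
  \<comment> \<open>Here \<open>\<alpha> * b = \<delta> / 2\<close>, so a step of length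
    \<open>b\<close> multiplies the upper bound by only \<open>exp (\<delta> / 2)\<close>, against
    \<open>exp \<delta>\<close> in \<open>lower\<close>.\<close>
  define \<alpha> where "\<alpha> = \<delta> / (2 * b)"
  have "\<alpha> > 0"
    using \<delta> \<open>b > 0\<close> by (simp add: \<alpha>_def)
  then obtain C where upper: "\<And>r. r > 0 \<Longrightarrow> J r \<le> C * exp (\<alpha> * r)"
    using assms(2) unfolding subexponentially_bounded_def by blast
  have bound: "J s * (n * (\<delta> / 2)) \<le> C * exp (\<alpha> * s)" for n :: nat
  proof -
    \<comment> \<open>One half of the exponent will cancel against the upper bound; the other half
      survives on the left.\<close>
    have "exp (n * (\<delta> / 2)) * (J s * exp (n * (\<delta> / 2))) = exp (n * \<delta>) * J s"
      by (simp add: exp_add[symmetric])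
    also have "\<dots> \<le> C * exp (\<alpha> * (s + n * b))"
      using lower[of n] upper[of "s + n * b"] s \<open>b > 0\<close>
      by (meson add_pos_nonneg less_imp_le mult_nonneg_nonneg of_nat_0_le_iff order_trans)
    also have "\<alpha> * (s + n * b) = n * (\<delta> / 2) + \<alpha> * s"
      using \<open>b > 0\<close> by (simp add: \<alpha>_def field_simps)
    finally have "J s * exp (n * (\<delta> / 2)) \<le> C * exp (\<alpha> * s)"
      by (simp add: exp_add mult.left_commute)
    \<comment> \<open>Linear growth in \<open>n\<close> is enough for the Archimedean argument
      below.\<close>
    moreover have "n * (\<delta> / 2) \<le> exp (n * (\<delta> / 2))"
      using exp_ge_add_one_self[of "n * (\<delta> / 2)"] by linarith
    ultimately show ?thesis
      using Js by (meson less_imp_le mult_left_mono order_trans)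
  qed
  \<comment> \<open>The right side of \<open>bound\<close> is free of \<open>n\<close>, while the
    slope on its left is positive because \<open>J s > 0\<close>.\<close>
  obtain n :: nat where "C * exp (\<alpha> * s) < n * (J s * (\<delta> / 2))"
    using reals_Archimedean3[of "J s * (\<delta> / 2)"] Js \<delta> by auto
  with bound[of n] show False
    by (simp add: algebra_simps)
qed

end
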